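(* Let $f\colon\mathbb{R}^d\to\mathbb{R}$ be a differentiable strongly convex function with minimum value $f^\star$ attained at $x^\star$, and let $\overline{\nabla} f$ be a weak discrete gradient of $f$ with parameters $(\alpha,\beta,\gamma)$ such that $\beta+\gamma>0$. Let $h>0$, $x_0,v_0\in\mathbb{R}^d$, and let $(x^{(k)})_{k\ge0}$, $(v^{(k)})_{k\ge0}$, $(z^{(k)})_{k\ge0}$ be sequences in $\mathbb{R}^d$ with $(x^{(0)},v^{(0)})=(x_0,v_0)$ satisfying, for all $k\ge 0$, $$\frac{x^{(k+1)}-x^{(k)}}{h}=\sqrt{2(\beta+\gamma)}\left(v^{(k+1)}-x^{(k+1)}\right),$$ $$\frac{v^{(k+1)}-v^{(k)}}{h}=\sqrt{2(\beta+\gamma)}\left(\frac{\beta}{\beta+\gamma}z^{(k)}+\frac{\gamma}{\beta+\gamma}x^{(k+1)}-v^{(k+1)}-\frac{\overline{\nabla} f\left(x^{(k+1)},z^{(k)}\right)}{2(\beta+\gamma)}\right),$$ $$\frac{z^{(k)}-x^{(k)}}{h}=\sqrt{2(\beta+\gamma)}\left(x^{(k)}+v^{(k)}-2z^{(k)}\right).$$ If $$h\le\overline{h}:=\frac{1}{\sqrt{2}\left(\sqrt{\alpha+\gamma}-\sqrt{\beta+\gamma}\right)},$$ then for all $k\ge 0$ $$f\left(x^{(k)}\right)-f^\star\le\left(1+\sqrt{2(\beta+\gamma)}\,h\right)^{-k}\left(f(x_0)-f^\star+(\beta+\gamma)\|v_0-x^\star\|^2\right).$$ In particular, if $h=\overline{h}$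 (with $\overline h$ finite), then for all $k\ge 0$ $$f\left(x^{(k)}\right)-f^\star\le\left(1-\sqrt{\frac{\beta+\gamma}{\alpha+\gamma}}\right)^{k}\left(f(x_0)-f^\star+(\beta+\gamma)\|v_0-x^\star\|^2\right).$$
   Context: $\mathbb{R}^d$ carries the standard inner product $\langle\cdot,\cdot\rangle$ and Euclidean norm $\|\cdot\|$. $f$ is strongly convex if $f-\frac{\mu}{2}\|\cdot\|^2$ is convex for some $\mu>0$. Weak discrete gradient: a map $\overline{\nabla} f\colon\mathbb{R}^d\times\mathbb{R}^d\to\mathbb{R}^d$ is a weak discrete gradient of $f$ with parameters $(\alpha,\beta,\gamma)$, where $\alpha\ge 0$ and $\beta+\gamma\ge 0$ are real numbers, if for all $x,y,z\in\mathbb{R}^d$ $$f(y)-f(x)\le\langle\overline{\nabla} f(y,z),y-x\rangle+\alpha\|y-z\|^2-\beta\|z-x\|^2-\gamma\|y-x\|^2$$ and $\overline{\nabla} f(x,x)=\nabla f(x)$. (Taking $x=y\neq z$ shows $\alpha\ge\beta$ when $d\ge1$, so the square roots are well defined.) Convention: $1/0=+\infty$, i.e. $\overline{h}=+\infty$ and there is no step size restriction when $\alpha=\beta$. *)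

theory Defs
  imports "HOL-Analysis.Analysis"
begin

definition strongly_convex :: "('a::real_inner \<Rightarrow> real) \<Rightarrow> bool"
  where "strongly_convex f \<longleftrightarrow>
    (\<exists>\<mu>>0. convex_on UNIV (\<lambda>x. f x - \<mu> / 2 * (norm x)\<^sup>2))"

text \<open>The condition on the diagonal, that the value at \<open>(x, x)\<close> be the gradient of \<open>f\<close> at \<open>x\<close>,
  is stated with the library's gradient relation, so it includes differentiability of \<open>f\<close>.\<close>

definition weak_discrete_gradient ::
    "('a::real_inner \<Rightarrow> real) \<Rightarrow> ('a \<Rightarrow> 'a \<Rightarrow> 'a) \<Rightarrow> real \<Rightarrow> real \<Rightarrow> real \<Rightarrow> bool"
  where "weak_discrete_gradient f g \<alpha> \<beta> \<gamma> \<longleftrightarrow>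
    \<alpha> \<ge> 0 \<and> \<beta> + \<gamma> \<ge> 0 \<and>
    (\<forall>x y z. f y - f x \<le> g y z \<bullet> (y - x)
        + \<alpha> * (norm (y - z))\<^sup>2 - \<beta> * (norm (z - x))\<^sup>2 - \<gamma> * (norm (y - x))\<^sup>2) \<and>
    (\<forall>x. GDERIV f x :> g x x)"

text \<open>The step size bound lives in the extended reals, where \<open>1 / 0 = \<infinity>\<close>; division by
  zero on the reals would give \<open>0\<close> when \<open>\<alpha> = \<beta>\<close>.\<close>

definition max_step :: "real \<Rightarrow> real \<Rightarrow> real \<Rightarrow> ereal"
  where "max_step \<alpha> \<beta> \<gamma> = 1 / ereal (sqrt 2 * (sqrt (\<alpha> + \<gamma>) - sqrt (\<beta> + \<gamma>)))"

end

theory Submission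
  imports Defs
begin

text \<open>
  Write \<open>m = \<beta> + \<gamma>\<close> and \<open>t = sqrt (2 * m) * h\<close>. The energy
  \<open>E k = f (x k) - fstar + m * (norm (v k - xstar))\<^sup>2\<close> satisfies \<open>(1 + t) * E (Suc k) \<le> E k\<close>:
  apply the weak discrete gradient inequality at \<open>(x k, x (Suc k), z k)\<close> and, with weight \<open>t\<close>, at
  \<open>(xstar, x (Suc k), z k)\<close>. The second scheme equation eliminates the gradient, all terms involving
  \<open>xstar\<close> cancel, and what is left is a quadratic form in \<open>u = v (Suc k) - x (Suc k)\<close> and
  \<open>w = (v k - x k) / (1 + 2 * t)\<close>, namely
  \<open>((\<alpha> + \<gamma>) * t\<^sup>2 - m * (1 + t)\<^sup>2) * (1 + t) * (norm (u - w))\<^sup>2 - m * t * (1 + 2 * t) * (norm w)\<^sup>2\<close>.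
  The first coefficient is nonpositive exactly under the step size restriction.
\<close>

text \<open>Here \<open>y\<close> plays the role of \<open>x k - xstar\<close>, so that \<open>x (Suc k) - xstar\<close>, \<open>z k - xstar\<close>,
  \<open>v k - xstar\<close> and \<open>v (Suc k) - xstar\<close> are \<open>y + t u\<close>, \<open>y + t w\<close>, \<open>y + (1 + 2 t) w\<close> and
  \<open>y + (1 + t) u\<close>.\<close>

lemma energy_identity:
  fixes u w y d :: "'a::real_inner" and \<alpha> \<beta> \<gamma> t :: real
  assumes d: "t *\<^sub>R d = t *\<^sub>R ((2 * \<beta> * t) *\<^sub>R w + (2 * \<gamma> * t) *\<^sub>R u - (2 * (\<beta> + \<gamma>) * (1 + t)) *\<^sub>R u)
    - (2 * (\<beta> + \<gamma>)) *\<^sub>R ((1 + t) *\<^sub>R u - (1 + 2 * t) *\<^sub>R w)"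
  shows "(d \<bullet> (t *\<^sub>R u) + \<alpha> * (norm (t *\<^sub>R (u - w)))\<^sup>2 - \<beta> * (norm (t *\<^sub>R w))\<^sup>2
        - \<gamma> * (norm (t *\<^sub>R u))\<^sup>2)
      + t * (d \<bullet> (y + t *\<^sub>R u) + \<alpha> * (norm (t *\<^sub>R (u - w)))\<^sup>2
        - \<beta> * (norm (y + t *\<^sub>R w))\<^sup>2 - \<gamma> * (norm (y + t *\<^sub>R u))\<^sup>2)
      + (1 + t) * (\<beta> + \<gamma>) * (norm (y + (1 + t) *\<^sub>R u))\<^sup>2
      - (\<beta> + \<gamma>) * (norm (y + (1 + 2 * t) *\<^sub>R w))\<^sup>2
    = ((\<alpha> + \<gamma>) * t\<^sup>2 - (\<beta> + \<gamma>) * (1 + t)\<^sup>2) * (1 + t) * (norm (u - w))\<^sup>2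
      - (\<beta> + \<gamma>) * t * (1 + 2 * t) * (norm w)\<^sup>2"
proof -
  \<comment> \<open>Merging the two gradient terms leaves \<open>d\<close> only through
    \<open>t *\<^sub>R d\<close>, which the assumption rewrites; the rest is a polynomial identity
    in inner products of \<open>u\<close>, \<open>w\<close> and \<open>y\<close>.\<close>
  have "d \<bullet> (t *\<^sub>R u) + t * (d \<bullet> (y + t *\<^sub>R u)) = (t *\<^sub>R d) \<bullet> (y + (1 + t) *\<^sub>R u)"
    by (simp add: inner_simps algebra_simps)
  then show ?thesis
    unfolding d power2_norm_eq_inner
    by (simp add: inner_simps inner_commute power2_eq_square algebra_simps)
qed

lemma weak_discrete_gradient_ineq:
  assumes "weak_discrete_gradient f g \<alpha> \<beta> \<gamma>"
  shows "f y - f x \<le> g y z \<bullet> (y - x)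
    + \<alpha> * (norm (y - z))\<^sup>2 - \<beta> * (norm (z - x))\<^sup>2 - \<gamma> * (norm (y - x))\<^sup>2"
  using assms unfolding weak_discrete_gradient_def by blast

lemma weak_discrete_gradient_le:
  fixes f :: "'a::euclidean_space \<Rightarrow> real"
  assumes "weak_discrete_gradient f g \<alpha> \<beta> \<gamma>"
  shows "\<beta> \<le> \<alpha>"
proof -
  obtain b :: 'a where "b \<in> Basis" using nonempty_Basis by blast
  then have "norm b = 1" by simp
  then show ?thesis
    \<comment> \<open>On the diagonal at 0 the function difference and the gradient term vanish,
      which leaves 0 \<le> \<alpha> - \<beta> for the unit vector \<open>b\<close>.\<close>
    using weak_discrete_gradient_ineq[OF assms, of 0 0 b] by simp
qed

text \<open>The scheme enters only through \<open>t\<close>, with \<open>h\<close> cleared from the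
  denominators; \<open>step\<close> fixes the sign of the first coefficient in the energy identity.
  The reference point \<open>p\<close> will be the minimizer.\<close>

lemma energy_step:
  fixes f :: "'a::real_inner \<Rightarrow> real"
  assumes wdg: "weak_discrete_gradient f g \<alpha> \<beta> \<gamma>"
    and m: "\<beta> + \<gamma> > 0" and t: "t > 0"
    and step: "(\<alpha> + \<gamma>) * t\<^sup>2 \<le> (\<beta> + \<gamma>) * (1 + t)\<^sup>2"
    and x': "x' - x = t *\<^sub>R (v' - x')"
    and v': "v' - v = t *\<^sub>R ((\<beta> / (\<beta> + \<gamma>)) *\<^sub>R z + (\<gamma> / (\<beta> + \<gamma>)) *\<^sub>R x' - v'
                - g x' z /\<^sub>R (2 * (\<beta> + \<gamma>)))"
    and z: "z - x = t *\<^sub>R (x + v - 2 *\<^sub>R z)"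
  shows "(1 + t) * (f x' - f p + (\<beta> + \<gamma>) * (norm (v' - p))\<^sup>2)
    \<le> f x - f p + (\<beta> + \<gamma>) * (norm (v - p))\<^sup>2"
proof -
  define u where "u = v' - x'"
  define w where "w = (v - x) /\<^sub>R (1 + 2 * t)"
  define y where "y = x - p"
  define d where "d = g x' z"
  have x'_eq: "x' = x + t *\<^sub>R u" using x' by (simp add: u_def algebra_simps)
  have v'_eq: "v' = x + (1 + t) *\<^sub>R u"
    using x'_eq by (simp add: u_def algebra_simps)
  have v_eq: "v = x + (1 + 2 * t) *\<^sub>R w"
    using t by (simp add: w_def)
  \<comment> \<open>The equation for \<open>z\<close> is implicit: since
    \<open>x + v - 2 *\<^sub>R z\<close> is \<open>(v - x) - 2 *\<^sub>R (z - x)\<close>, collecting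
    \<open>z - x\<close> solves it. This explains the normalization of \<open>w\<close>.\<close>
  have "(1 + 2 * t) *\<^sub>R (z - x) = t *\<^sub>R (v - x)"
  proof -
    have "(1 + 2 * t) *\<^sub>R (z - x) = (z - x) + (2 * t) *\<^sub>R (z - x)"
      by (simp add: scaleR_left_distrib)
    also have "\<dots> = t *\<^sub>R (x + v - 2 *\<^sub>R z) + (2 * t) *\<^sub>R (z - x)" using z by simp
    also have "\<dots> = t *\<^sub>R (v - x)" by (simp add: algebra_simps flip: scaleR_left_distrib)
    finally show ?thesis .
  qed
  also have "\<dots> = (1 + 2 * t) *\<^sub>R (t *\<^sub>R w)" by (simp add: v_eq)
  finally have "z - x = t *\<^sub>R w" using t by (simp only: scaleR_cancel_left) simp
  then have z_eq: "z = x + t *\<^sub>R w" by (simp add: algebra_simps)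
  have "(2 * (\<beta> + \<gamma>)) *\<^sub>R (v' - v)
    = t *\<^sub>R ((2 * \<beta>) *\<^sub>R z + (2 * \<gamma>) *\<^sub>R x' - (2 * (\<beta> + \<gamma>)) *\<^sub>R v' - d)"
  proof -
    have scale: "2 * (\<beta> + \<gamma>) * (b / (\<beta> + \<gamma>)) = 2 * b" for b
      using m by (simp del: distrib_left_numeral)
    have "(2 * (\<beta> + \<gamma>)) *\<^sub>R (v' - v)
      = t *\<^sub>R ((2 * (\<beta> + \<gamma>)) *\<^sub>R ((\<beta> / (\<beta> + \<gamma>)) *\<^sub>R z + (\<gamma> / (\<beta> + \<gamma>)) *\<^sub>R x' - v'
                - d /\<^sub>R (2 * (\<beta> + \<gamma>))))"
      by (simp only: v' d_def scaleR_left_commute)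
    also have "\<dots> = t *\<^sub>R ((2 * \<beta>) *\<^sub>R z + (2 * \<gamma>) *\<^sub>R x' - (2 * (\<beta> + \<gamma>)) *\<^sub>R v' - d)"
      using m by (simp only: scaleR_right_diff_distrib scaleR_right_distrib scaleR_scaleR scale) simp
    finally show ?thesis .
  qed
  \<comment> \<open>The coefficients of \<open>z\<close>, \<open>x'\<close> and \<open>v'\<close>
    sum to zero, so the base point \<open>x\<close> drops out.\<close>
  then have d_eq: "t *\<^sub>R d
    = t *\<^sub>R ((2 * \<beta> * t) *\<^sub>R w + (2 * \<gamma> * t) *\<^sub>R u - (2 * (\<beta> + \<gamma>) * (1 + t)) *\<^sub>R u)
      - (2 * (\<beta> + \<gamma>)) *\<^sub>R ((1 + t) *\<^sub>R u - (1 + 2 * t) *\<^sub>R w)"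
    unfolding x'_eq v'_eq v_eq z_eq by (simp add: algebra_simps)
  have diffs: "x' - x = t *\<^sub>R u" "x' - z = t *\<^sub>R (u - w)" "z - x = t *\<^sub>R w"
    "x' - p = y + t *\<^sub>R u" "z - p = y + t *\<^sub>R w"
    "v' - p = y + (1 + t) *\<^sub>R u" "v - p = y + (1 + 2 * t) *\<^sub>R w"
    unfolding x'_eq v'_eq v_eq z_eq y_def by (simp_all add: algebra_simps)
  have "f x' - f x \<le> d \<bullet> (t *\<^sub>R u) + \<alpha> * (norm (t *\<^sub>R (u - w)))\<^sup>2 - \<beta> * (norm (t *\<^sub>R w))\<^sup>2
        - \<gamma> * (norm (t *\<^sub>R u))\<^sup>2"
    using weak_discrete_gradient_ineq[OF wdg, of x' x z] by (simp only: diffs d_def)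
  moreover have "t * (f x' - f p) \<le> t * (d \<bullet> (y + t *\<^sub>R u) + \<alpha> * (norm (t *\<^sub>R (u - w)))\<^sup>2
        - \<beta> * (norm (y + t *\<^sub>R w))\<^sup>2 - \<gamma> * (norm (y + t *\<^sub>R u))\<^sup>2)"
    using weak_discrete_gradient_ineq[OF wdg, of x' p z] t
    by (intro mult_left_mono) (simp_all only: diffs d_def)
  moreover have "((\<alpha> + \<gamma>) * t\<^sup>2 - (\<beta> + \<gamma>) * (1 + t)\<^sup>2) * (1 + t) * (norm (u - w))\<^sup>2 \<le> 0"
    using step t by (intro mult_nonpos_nonneg) auto
  moreover have "(\<beta> + \<gamma>) * t * (1 + 2 * t) * (norm w)\<^sup>2 \<ge> 0"
    using m t by (intro mult_nonneg_nonneg) auto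
  moreover note energy_identity[OF d_eq, of \<alpha> y]
  moreover have "(1 + t) * (f x' - f p + (\<beta> + \<gamma>) * (norm (v' - p))\<^sup>2)
      - (f x - f p + (\<beta> + \<gamma>) * (norm (v - p))\<^sup>2)
    = (f x' - f x) + t * (f x' - f p) + (1 + t) * (\<beta> + \<gamma>) * (norm (v' - p))\<^sup>2
      - (\<beta> + \<gamma>) * (norm (v - p))\<^sup>2"
    by (simp add: algebra_simps)
  ultimately show ?thesis unfolding diffs by linarith
qed

text \<open>For \<alpha> = \<beta> the bound is infinite and both sides hold. Otherwise the
  denominator is positive, as \<open>sqrt\<close> is strictly increasing on all reals.\<close>

lemma le_max_step_iff:
  assumes "\<beta> \<le> \<alpha>"
  shows "ereal h \<le> max_step \<alpha> \<beta> \<gamma>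
    \<longleftrightarrow> sqrt 2 * h * (sqrt (\<alpha> + \<gamma>) - sqrt (\<beta> + \<gamma>)) \<le> 1"
proof (cases "\<alpha> = \<beta>")
  case True
  then show ?thesis by (simp add: max_step_def divide_ereal_def flip: zero_ereal_def)
next
  case False
  with assms have "sqrt (\<alpha> + \<gamma>) - sqrt (\<beta> + \<gamma>) > 0" by simp
  then show ?thesis
    by (simp add: max_step_def one_ereal_def field_simps)
qed

text \<open>For \<alpha> = \<beta> both sides fail: \<open>ereal h\<close> is finite and 0 differs
  from 1.\<close>

lemma eq_max_step_iff:
  assumes "\<beta> \<le> \<alpha>"
  shows "ereal h = max_step \<alpha> \<beta> \<gamma>
    \<longleftrightarrow> sqrt 2 * h * (sqrt (\<alpha> + \<gamma>) - sqrt (\<beta> + \<gamma>)) = 1"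
proof (cases "\<alpha> = \<beta>")
  case True
  then show ?thesis by (simp add: max_step_def divide_ereal_def flip: zero_ereal_def)
next
  case False
  with assms have "sqrt (\<alpha> + \<gamma>) - sqrt (\<beta> + \<gamma>) > 0" by simp
  then show ?thesis
    by (simp add: max_step_def one_ereal_def field_simps)
qed

theorem theorem3p7:
  fixes f :: "real ^ 'n \<Rightarrow> real"
    and g :: "real ^ 'n \<Rightarrow> real ^ 'n \<Rightarrow> real ^ 'n"
    and \<alpha> \<beta> \<gamma> h fstar :: real
    and xstar x0 v0 :: "real ^ 'n"
    and x v z :: "nat \<Rightarrow> real ^ 'n"
  assumes "\<forall>y. f differentiable (at y)"
    and "strongly_convex f"
    and "f xstar = fstar" and "\<forall>y. fstar \<le> f y"
    and "weak_discrete_gradient f g \<alpha> \<beta> \<gamma>"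
    and "\<beta> + \<gamma> > 0"
    and "h > 0"
    and "x 0 = x0" and "v 0 = v0"
    and "\<forall>k. (x (Suc k) - x k) /\<^sub>R h
           = sqrt (2 * (\<beta> + \<gamma>)) *\<^sub>R (v (Suc k) - x (Suc k))"
    and "\<forall>k. (v (Suc k) - v k) /\<^sub>R h
           = sqrt (2 * (\<beta> + \<gamma>)) *\<^sub>R
               ((\<beta> / (\<beta> + \<gamma>)) *\<^sub>R z k + (\<gamma> / (\<beta> + \<gamma>)) *\<^sub>R x (Suc k) - v (Suc k)
                - g (x (Suc k)) (z k) /\<^sub>R (2 * (\<beta> + \<gamma>)))"
    and "\<forall>k. (z k - x k) /\<^sub>R h
           = sqrt (2 * (\<beta> + \<gamma>)) *\<^sub>R (x k + v k - 2 *\<^sub>R z k)"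
    and "ereal h \<le> max_step \<alpha> \<beta> \<gamma>"
  shows "(\<forall>k. f (x k) - fstar
           \<le> (1 + sqrt (2 * (\<beta> + \<gamma>)) * h) powi (- int k)
               * (f x0 - fstar + (\<beta> + \<gamma>) * (norm (v0 - xstar))\<^sup>2))
    \<and> (ereal h = max_step \<alpha> \<beta> \<gamma> \<longrightarrow>
        (\<forall>k. f (x k) - fstar
           \<le> (1 - sqrt ((\<beta> + \<gamma>) / (\<alpha> + \<gamma>))) ^ k
               * (f x0 - fstar + (\<beta> + \<gamma>) * (norm (v0 - xstar))\<^sup>2)))"
proof -
  note wdg = assms(5) and m = assms(6)
  define t where "t = sqrt (2 * (\<beta> + \<gamma>)) * h"
  define A where "A = sqrt (\<alpha> + \<gamma>)"
  define B where "B = sqrt (\<beta> + \<gamma>)"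
  define E where "E k = f (x k) - fstar + (\<beta> + \<gamma>) * (norm (v k - xstar))\<^sup>2" for k
  have le: "\<beta> \<le> \<alpha>" using weak_discrete_gradient_le[OF wdg] .
  have t: "t > 0" using m assms(7) by (simp add: t_def)
  have B: "B > 0" and A: "A > 0" using m le by (auto simp: A_def B_def)
  have t_eq: "t = sqrt 2 * h * B" by (simp only: t_def B_def real_sqrt_mult ac_simps)
  \<comment> \<open>Multiplying the step size bound by \<open>B\<close> turns it into
    \<open>A * t \<le> B * (1 + t)\<close>, whose square is the condition of
    \<open>energy_step\<close>.\<close>
  have "t * (A - B) = B * (sqrt 2 * h * (A - B))" by (simp add: t_eq)
  also have "\<dots> \<le> B * 1"
    using assms(13) B unfolding le_max_step_iff[OF le] A_def B_def
    by (intro mult_left_mono) auto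
  finally have "A * t \<le> B * (1 + t)" by (simp add: algebra_simps)
  then have "(A * t)\<^sup>2 \<le> (B * (1 + t))\<^sup>2"
    using A t by (intro power_mono) auto
  then have step: "(\<alpha> + \<gamma>) * t\<^sup>2 \<le> (\<beta> + \<gamma>) * (1 + t)\<^sup>2"
    using m le by (simp add: A_def B_def power_mult_distrib)
  have unscale: "a = (c * h) *\<^sub>R b" if "a /\<^sub>R h = c *\<^sub>R b" for a b :: "real ^ 'n" and c
  proof -
    have "a = h *\<^sub>R (a /\<^sub>R h)" using assms(7) by simp
    then show ?thesis using that by (simp add: mult.commute)
  qed
  have decay: "(1 + t) * E (Suc k) \<le> E k" for k
    unfolding E_def assms(3)[symmetric] t_def
    using assms(10-12)
    by (intro energy_step[where z = "z k", OF wdg m t[unfolded t_def] step[unfolded t_def]] unscale) blast+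
  have "(1 + t) ^ k * E k \<le> E 0" for k
  proof (induction k)
    case (Suc k)
    have "(1 + t) ^ Suc k * E (Suc k) = (1 + t) ^ k * ((1 + t) * E (Suc k))" by simp
    also have "\<dots> \<le> (1 + t) ^ k * E k" using decay t by (intro mult_left_mono) auto
    finally show ?case using Suc.IH by linarith
  qed simp
  then have "E k \<le> inverse ((1 + t) ^ k) * E 0" for k
    using t by (simp add: field_simps)
  moreover have "f (x k) - fstar \<le> E k" for k using m by (simp add: E_def)
  ultimately have rate: "f (x k) - fstar \<le> inverse (1 + t) ^ k * E 0" for k
    by (metis order_trans power_inverse)
  have E0: "E 0 = f x0 - fstar + (\<beta> + \<gamma>) * (norm (v0 - xstar))\<^sup>2"
    using assms(8,9) by (simp add: E_def)
  \<comment> \<open>At the maximal step \<open>t * (A - B) = B\<close>, so \<open>1 + t\<close>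
    equals \<open>A / (A - B)\<close>.\<close>
  have "inverse (1 + t) = 1 - sqrt ((\<beta> + \<gamma>) / (\<alpha> + \<gamma>))" if "ereal h = max_step \<alpha> \<beta> \<gamma>"
  proof -
    have "sqrt 2 * h * (A - B) = 1"
      using that unfolding eq_max_step_iff[OF le] A_def B_def .
    then have "t * (A - B) = B" by (simp add: t_eq)
    then have "(1 + t) * (1 - B / A) = 1" using A by (simp add: field_simps)
    then show ?thesis by (simp add: inverse_unique real_sqrt_divide A_def B_def)
  qed
  moreover have "inverse (1 + t) ^ k = (1 + t) powi (- int k)" for k
    by (simp add: power_int_minus power_inverse)
  ultimately show ?thesis
    using rate unfolding E0 by (metis t_def)
qed

end
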